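(* Let $S, K$ be two non-commutative subrings of a finite ring $R$ such that $S \subseteq K$. Then $X = (S + C_K(S)) \setminus C_K(S)$ is a dominating set for $\Gamma_{S,K}$.
   Context: Rings are associative and not assumed to have a unity. For subrings $S \subseteq K$ of a finite ring $R$, put $C_K(S) = \{k \in K : ks = sk \ \forall s \in S\}$, and $S + C_K(S) = \{s + c : s \in S, c \in C_K(S)\}$. The generalized non-commuting graph $\Gamma_{S,K}$ (for $S \subseteq K$) is the simple graph with vertex set $K \setminus C_K(S)$ in which two distinct vertices $a, b$ are adjacent if and only if ($a \in S$ or $b \in S$) and $ab \neq ba$. A subset $D$ of the vertex set of a graph $G$ is a dominating set for $G$ if every vertex of $G$ not in $D$ is adjacent to at least one member of $D$. *)

theory Defs
  imports Main "HOL-Library.Set_Algebras"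
begin

text \<open>The class \<open>ring\<close> consists of associative rings without a unity requirement, so
  subrings are additive subgroups closed under multiplication, and need not contain a unity.\<close>

definition subring :: "'a::ring set \<Rightarrow> bool" where
  "subring S \<longleftrightarrow>
     0 \<in> S \<and> (\<forall>x\<in>S. \<forall>y\<in>S. x + y \<in> S) \<and> (\<forall>x\<in>S. - x \<in> S) \<and> (\<forall>x\<in>S. \<forall>y\<in>S. x * y \<in> S)"

definition noncommutative :: "'a::ring set \<Rightarrow> bool" where
  "noncommutative S \<longleftrightarrow> (\<exists>x\<in>S. \<exists>y\<in>S. x * y \<noteq> y * x)"

definition centralizer :: "'a::ring set \<Rightarrow> 'a set \<Rightarrow> 'a set" where
  "centralizer K S = {k \<in> K. \<forall>s\<in>S. k * s = s * k}"

text \<open>A simple graph is given by its vertex set and its set of edges, each edge being an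
  unordered pair of distinct vertices.\<close>

record 'v graph =
  vertices :: "'v set"
  edges :: "'v set set"

definition simple_graph :: "'v graph \<Rightarrow> bool" where
  "simple_graph G \<longleftrightarrow>
     (\<forall>e\<in>edges G. \<exists>a\<in>vertices G. \<exists>b\<in>vertices G. a \<noteq> b \<and> e = {a, b})"

definition adjacent :: "'v graph \<Rightarrow> 'v \<Rightarrow> 'v \<Rightarrow> bool" where
  "adjacent G a b \<longleftrightarrow> {a, b} \<in> edges G"

definition dominating_set :: "'v graph \<Rightarrow> 'v set \<Rightarrow> bool" where
  "dominating_set G D \<longleftrightarrow>
     D \<subseteq> vertices G \<and> (\<forall>v\<in>vertices G - D. \<exists>d\<in>D. adjacent G v d)"

definition noncommuting_graph :: "'a::ring set \<Rightarrow> 'a set \<Rightarrow> 'a graph" where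
  "noncommuting_graph S K =
     \<lparr>vertices = K - centralizer K S,
      edges = {{a, b} | a b. a \<in> K - centralizer K S \<and> b \<in> K - centralizer K S \<and> a \<noteq> b \<and>
                 (a \<in> S \<or> b \<in> S) \<and> a * b \<noteq> b * a}\<rparr>"

lemma simple_graph_noncommuting_graph: "simple_graph (noncommuting_graph S K)"
  unfolding simple_graph_def noncommuting_graph_def by auto

lemma adjacent_noncommuting_graph_iff:
  "adjacent (noncommuting_graph S K) a b \<longleftrightarrow>
     a \<in> K - centralizer K S \<and> b \<in> K - centralizer K S \<and> a \<noteq> b \<and>
     (a \<in> S \<or> b \<in> S) \<and> a * b \<noteq> b * a"
  unfolding adjacent_def noncommuting_graph_def by (auto simp: doubleton_eq_iff)

end

theory Submission imports Defs begin

text \<open>Produces a neighbour of any vertex \<open>v\<close> inside \<open>S\<close>, which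
  settles the edge condition that one endpoint lie in \<open>S\<close>. The difficulty is that an
  element of \<open>S\<close> not commuting with \<open>v\<close> may centralize \<open>S\<close>,
  and then it is not a vertex.\<close>

lemma noncentral_noncommuting_witness:
  fixes S K :: "'a::ring set"
  assumes S: "subring S" and nc: "noncommutative S" and sub: "S \<subseteq> K"
    and v: "v \<in> K - centralizer K S"
  obtains d where "d \<in> S" "d \<notin> centralizer K S" "v * d \<noteq> d * v"
proof -
  obtain s where s: "s \<in> S" "v * s \<noteq> s * v"
    using v by (auto simp: centralizer_def)
  \<comment> \<open>\<open>t\<close> is the fallback when \<open>s\<close> centralizes
    \<open>S\<close>: the partner \<open>u\<close> certifies that \<open>t\<close> does not.\<close>
  obtain t u where t: "t \<in> S" and u: "u \<in> S" "t * u \<noteq> u * t"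
    using nc by (auto simp: noncommutative_def)
  have t_nc: "t \<notin> centralizer K S"
    using u by (auto simp: centralizer_def)
  consider "s \<notin> centralizer K S" | "v * t \<noteq> t * v" | "s \<in> centralizer K S" "v * t = t * v"
    by blast
  then show thesis
  proof cases
    case 1
    then show thesis using s that by blast
  next
    case 2
    then show thesis using t t_nc that by blast
  next
    \<comment> \<open>\<open>s\<close> commutes with \<open>u\<close> but not with \<open>v\<close>, and \<open>t\<close> with \<open>v\<close> but not with \<open>u\<close>,
      so \<open>s + t\<close> commutes with neither.\<close>
    case 3
    have "s * u = u * s"
      using 3(1) u(1) by (simp add: centralizer_def)
    then have "(s + t) * u \<noteq> u * (s + t)"
      using u(2) by (simp add: algebra_simps)
    then have "s + t \<notin> centralizer K S"
      using u(1) by (auto simp: centralizer_def)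
    moreover have "v * (s + t) \<noteq> (s + t) * v"
      using s(2) 3(2) by (simp add: algebra_simps)
    moreover have "s + t \<in> S"
      using S s(1) t by (simp add: subring_def)
    ultimately show thesis using that by blast
  qed
qed

theorem proposition3p6:
  fixes S K :: "'a::{ring, finite} set"
  assumes "subring S" and "subring K"
    and "noncommutative S" and "noncommutative K"
    and "S \<subseteq> K"
  shows "dominating_set (noncommuting_graph S K) ((S + centralizer K S) - centralizer K S)"
proof -
  let ?C = "centralizer K S"
  let ?X = "(S + ?C) - ?C"
  have "S + ?C \<subseteq> K"
    using assms(2,5) by (auto simp: subring_def centralizer_def elim!: set_plus_elim)
  \<comment> \<open>Writing \<open>d\<close> as \<open>d + 0\<close> places every element of
    \<open>S\<close> in \<open>S + ?C\<close>, so a witness from \<open>S\<close> outside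
    \<open>?C\<close> lies in \<open>?X\<close>.\<close>
  moreover have "0 \<in> ?C"
    using assms(2) by (simp add: subring_def centralizer_def)
  then have S_sub: "S \<subseteq> S + ?C"
    using set_plus_intro[of _ S 0 ?C] by auto
  moreover have "\<exists>d\<in>?X. adjacent (noncommuting_graph S K) v d" if v: "v \<in> K - ?C - ?X" for v
  proof -
    obtain d where d: "d \<in> S" "d \<notin> ?C" "v * d \<noteq> d * v"
      using noncentral_noncommuting_witness[OF assms(1,3,5)] v by blast
    \<comment> \<open>Distinctness of \<open>v\<close> and \<open>d\<close> is automatic, since
      every element commutes with itself.\<close>
    then have "adjacent (noncommuting_graph S K) v d"
      using v assms(5) by (auto simp: adjacent_noncommuting_graph_iff)
    then show ?thesis using d S_sub by blast
  qed
  ultimately show ?thesis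
    by (auto simp: dominating_set_def noncommuting_graph_def)
qed

end
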